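(* Let $n>d\ge 2$ be integers and let $(x_i)_{i=1}^n$ be a random Parseval frame in $\mathbb{R}^d$, drawn from the symmetric measure on the Stiefel manifold $\mathrm{St}(n,d)$. Let $\varepsilon>0$ and assume that $n$ is sufficiently large so that $$\frac{3\sqrt{17}}{4}\sqrt{\frac{d+\ln n}{n}}<\varepsilon .$$ Then $$\mathbb{P}\left(\exists\, i\in\{1,\dots,n\}\text{ such that }\bigl|\,\|x_i\|-\sqrt{d/n}\,\bigr|\ge\varepsilon\right)\le\exp\left(-\frac{n-2}{8}\left(\varepsilon-\frac{3\sqrt{17}}{4}\sqrt{\frac{d+\ln n}{n}}\right)^2\right).$$
   Context: A finite sequence $(x_i)_{i=1}^n$ of vectors in $\mathbb{R}^d$ is a Parseval frame if its frame operator $S=\sum_{i=1}^n x_ix_i^*$ equals $I_d$. Identifying the sequence with the matrix $U\in\mathbb{R}^{n\times d}$ whose rows are the $x_i$, Parseval frames correspond to points of the Stiefel manifold $\mathrm{St}(n,d)=\{U\in\mathbb{R}^{n\times d}: U^*U=I_d\}$. The canonical Riemannian metric on $\mathrm{St}(n,d)$ is $(\Delta_1,\Delta_2)\mapsto \mathrm{Tr}\bigl(\Delta_1^*(I_n-\tfrac12UU^* )\Delta_2\bigr)$ for $\Delta_1,\Delta_2$ in the tangent space $T_U\mathrm{St}(n,d)=\{\Delta\in\mathbb{R}^{n\times d}:U^*\Delta+\Delta^*U=0\}$. The symmetric measure is the associated Riemannian volume measure normalized to a probability measure (the Haar measure). $\|\cdot\|$ is the Euclidean norm. *)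

theory Defs
  imports "HOL-Analysis.Analysis"
begin

section \<open>Parseval frames and the Stiefel manifold\<close>

definition parseval_frame :: "('n::finite \<Rightarrow> real^'d) \<Rightarrow> bool" where
  "parseval_frame x \<longleftrightarrow> (\<Sum>i\<in>UNIV. (\<chi> j k. x i $ j * x i $ k)) = (mat 1 :: real^'d^'d)"

definition stiefel :: "(real^'d^'n) set" where
  "stiefel = {U. transpose U ** U = mat 1}"

lemma mem_stiefel_iff_parseval_frame:
  fixes U :: "real^'d^'n"
  shows "U \<in> stiefel \<longleftrightarrow> parseval_frame (\<lambda>i. U $ i)"
  by (simp add: stiefel_def parseval_frame_def vec_eq_iff matrix_matrix_mult_def transpose_def)

definition canonical_metric ::
    "real^'d^'n \<Rightarrow> real^'d^'n \<Rightarrow> real^'d^'n \<Rightarrow> real" where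
  "canonical_metric U \<Delta>\<^sub>1 \<Delta>\<^sub>2 =
     trace (transpose \<Delta>\<^sub>1 ** (mat 1 - (1/2) *\<^sub>R (U ** transpose U)) ** \<Delta>\<^sub>2)"


section \<open>Riemannian volume\<close>

text \<open>An index type with as many elements as the dimension $nd - d(d+1)/2$ of the manifold.
  The \<open>max\<close> only keeps the type nonempty; for $n > d \ge 1$ it has no effect.\<close>

typedef ('n::finite, 'd::finite) stiefel_index =
  "{..< max 1 (CARD('n) * CARD('d) - CARD('d) * (CARD('d) + 1) div 2)}"
  by (rule exI[of _ 0]) simp

instance stiefel_index :: (finite, finite) finite
proof
  show "finite (UNIV :: ('a, 'b) stiefel_index set)"
    by (simp add: type_definition.univ[OF type_definition_stiefel_index])
qed

lemma CARD_stiefel_index: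
  "CARD(('n::finite, 'd::finite) stiefel_index) =
     max 1 (CARD('n) * CARD('d) - CARD('d) * (CARD('d) + 1) div 2)"
  by (simp add: type_definition.card[OF type_definition_stiefel_index])

type_synonym ('n, 'd) stiefel_coords = "real^('n, 'd) stiefel_index"

text \<open>Local parametrizations, i.e. inverses of charts: injective $C^1$ immersions of open sets of
  coordinates. Continuity of the inverse is automatic since the dimensions agree.\<close>

definition stiefel_param ::
    "('n::finite, 'd::finite) stiefel_coords set \<Rightarrow>
     (('n, 'd) stiefel_coords \<Rightarrow> real^'d^'n) \<Rightarrow> bool" where
  "stiefel_param V \<phi> \<longleftrightarrow>
     open V \<and> \<phi> ` V \<subseteq> stiefel \<and> inj_on \<phi> V \<and>
     (\<forall>x\<in>V. \<phi> differentiable (at x)) \<and>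
     (\<forall>h. continuous_on V (\<lambda>x. frechet_derivative \<phi> (at x) h)) \<and>
     (\<forall>x\<in>V. inj (frechet_derivative \<phi> (at x)))"

definition metric_matrix ::
    "(('n::finite, 'd::finite) stiefel_coords \<Rightarrow> real^'d^'n) \<Rightarrow> ('n, 'd) stiefel_coords \<Rightarrow>
     real^('n, 'd) stiefel_index^('n, 'd) stiefel_index" where
  "metric_matrix \<phi> x = (\<chi> j k. canonical_metric (\<phi> x)
     (frechet_derivative \<phi> (at x) (axis j 1)) (frechet_derivative \<phi> (at x) (axis k 1)))"

definition param_volume ::
    "(('n::finite, 'd::finite) stiefel_coords \<Rightarrow> real^'d^'n) \<Rightarrow>
     ('n, 'd) stiefel_coords set \<Rightarrow> ennreal" where
  "param_volume \<phi> B = (\<integral>\<^sup>+ x\<in>B. ennreal (sqrt (det (metric_matrix \<phi> x))) \<partial>lborel)"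

text \<open>The volume of \<open>\<phi> ` B\<close> is \<open>param_volume \<phi> B\<close> for every parametrization \<open>\<phi>\<close>. The volume of a
  set not contained in a single coordinate patch is obtained by cutting it into countably many
  Borel pieces, each inside a patch, and adding up; since overlaps only increase the sum, this
  is the infimum over all countable coverings by such pieces.\<close>

definition riemannian_volume :: "(real^'d^'n) set \<Rightarrow> ennreal" where
  "riemannian_volume A =
     Inf {\<Sum>k. param_volume (\<phi> k) (B k) | \<phi> V B.
       (\<forall>k::nat. stiefel_param (V k) (\<phi> k) \<and> B k \<in> sets borel \<and> B k \<subseteq> V k) \<and>
       A \<subseteq> (\<Union>k. \<phi> k ` B k)}"

definition stiefel_volume :: "(real^'d^'n) measure" where
  "stiefel_volume = measure_of stiefel (sets (restrict_space borel stiefel)) riemannian_volume"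

definition stiefel_symmetric :: "(real^'d^'n) measure" where
  "stiefel_symmetric = uniform_measure stiefel_volume stiefel"


subsection \<open>The volume is a measure\<close>

lemma stiefel_param_continuous_on:
  assumes "stiefel_param V \<phi>" shows "continuous_on V \<phi>"
  using assms unfolding stiefel_param_def
  by (meson continuous_at_imp_continuous_on differentiable_imp_continuous_within)

lemma borel_measurable_metric_density:
  fixes \<phi> :: "('n::finite, 'd::finite) stiefel_coords \<Rightarrow> real^'d^'n"
  assumes \<phi>: "stiefel_param V \<phi>"
  shows "(\<lambda>x. ennreal (sqrt (det (metric_matrix \<phi> x))) * indicator V x) \<in> borel_measurable borel"
proof -
  have D: "continuous_on V (\<lambda>x. frechet_derivative \<phi> (at x) h)" for h
    using \<phi> by (simp add: stiefel_param_def)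
  have "continuous_on V (\<lambda>x. sqrt (det (metric_matrix \<phi> x)))"
    unfolding det_def metric_matrix_def canonical_metric_def trace_def matrix_matrix_mult_def
      transpose_def mat_def
    by (simp add: power2_eq_square)
       (intro continuous_intros D stiefel_param_continuous_on[OF \<phi>]; simp)
  moreover have "V \<in> sets borel"
    using \<phi> by (simp add: stiefel_param_def)
  ultimately have "(\<lambda>x. indicator V x *\<^sub>R sqrt (det (metric_matrix \<phi> x))) \<in> borel_measurable borel"
    by (intro borel_measurable_continuous_on_indicator)
  then have "(\<lambda>x. ennreal (indicator V x *\<^sub>R sqrt (det (metric_matrix \<phi> x)))) \<in> borel_measurable borel"
    by measurable
  also have "(\<lambda>x. ennreal (indicator V x *\<^sub>R sqrt (det (metric_matrix \<phi> x)))) =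
      (\<lambda>x. ennreal (sqrt (det (metric_matrix \<phi> x))) * indicator V x)"
    by (auto simp: fun_eq_iff indicator_def)
  finally show ?thesis .
qed

lemma param_volume_eq_emeasure:
  assumes "stiefel_param V \<phi>" "B \<in> sets borel" "B \<subseteq> V"
  shows "param_volume \<phi> B =
    emeasure (density lborel (\<lambda>x. ennreal (sqrt (det (metric_matrix \<phi> x))) * indicator V x)) B"
proof -
  have "param_volume \<phi> B =
      (\<integral>\<^sup>+ x. ennreal (sqrt (det (metric_matrix \<phi> x))) * indicator V x * indicator B x \<partial>lborel)"
    unfolding param_volume_def using assms(3)
    by (intro nn_integral_cong) (auto simp: indicator_def)
  then show ?thesis
    using borel_measurable_metric_density[OF assms(1)] assms(2)
    by (subst emeasure_density) auto
qed

lemma riemannian_volume_le: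
  assumes "\<And>k::nat. stiefel_param (V k) (\<phi> k)" "\<And>k. B k \<in> sets borel" "\<And>k. B k \<subseteq> V k"
    and "A \<subseteq> (\<Union>k. \<phi> k ` B k)"
  shows "riemannian_volume A \<le> (\<Sum>k. param_volume (\<phi> k) (B k))"
  unfolding riemannian_volume_def using assms by (intro Inf_lower) blast

lemma riemannian_volume_approx:
  fixes A :: "(real^'d^'n) set"
  assumes "riemannian_volume A < c"
  obtains \<phi> V B where "\<And>k::nat. stiefel_param (V k) (\<phi> k)" "\<And>k. B k \<in> sets borel"
    "\<And>k. B k \<subseteq> V k" "A \<subseteq> (\<Union>k. \<phi> k ` B k)" "(\<Sum>k. param_volume (\<phi> k) (B k)) < c"
  using assms unfolding riemannian_volume_def Inf_less_iff by blast

lemma riemannian_volume_empty: "riemannian_volume ({} :: (real^'d^'n) set) = 0"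
proof -
  have "stiefel_param {} (\<lambda>_. 0 :: real^'d^'n)"
    by (simp add: stiefel_param_def)
  then have "riemannian_volume ({} :: (real^'d^'n) set) \<le>
      (\<Sum>k::nat. param_volume (\<lambda>_. 0 :: real^'d^'n) {})"
    by (intro riemannian_volume_le[where V = "\<lambda>_. {}"]) auto
  then show ?thesis by (simp add: param_volume_def)
qed

lemma riemannian_volume_subadditive:
  fixes A :: "nat \<Rightarrow> (real^'d^'n) set"
  shows "riemannian_volume (\<Union>i. A i) \<le> (\<Sum>i. riemannian_volume (A i))"
proof (rule ennreal_le_epsilon)
  fix e :: real
  assume fin: "(\<Sum>i. riemannian_volume (A i)) < top" and e: "0 < e"
  have lt: "riemannian_volume (A i) < riemannian_volume (A i) + ennreal (e * (1/2) ^ Suc i)" for i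
  proof -
    have "riemannian_volume (A i) \<noteq> top"
      using fin ennreal_suminf_lessD less_top by blast
    then show ?thesis
      using e by (simp add: less_top ennreal_add_left_cancel_less[of _ 0, simplified])
  qed
  define Q where "Q i \<phi> V B \<longleftrightarrow>
      (\<forall>k::nat. stiefel_param (V k) (\<phi> k) \<and> B k \<in> sets borel \<and> B k \<subseteq> V k) \<and>
      A i \<subseteq> (\<Union>k. \<phi> k ` B k) \<and>
      (\<Sum>k. param_volume (\<phi> k) (B k)) < riemannian_volume (A i) + ennreal (e * (1/2) ^ Suc i)"
    for i \<phi> V B
  have "\<forall>i. \<exists>\<phi> V B. Q i \<phi> V B"
  proof
    fix i
    obtain \<phi> V B where "\<And>k::nat. stiefel_param (V k) (\<phi> k)" "\<And>k. B k \<in> sets borel"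
      "\<And>k. B k \<subseteq> V k" "A i \<subseteq> (\<Union>k. \<phi> k ` B k)"
      "(\<Sum>k. param_volume (\<phi> k) (B k)) < riemannian_volume (A i) + ennreal (e * (1/2) ^ Suc i)"
      by (rule riemannian_volume_approx[OF lt[of i]]) (rule that)
    then have "Q i \<phi> V B"
      unfolding Q_def by blast
    then show "\<exists>\<phi> V B. Q i \<phi> V B"
      by blast
  qed
  from choice[OF this] obtain \<phi> where "\<forall>i. \<exists>V B. Q i (\<phi> i) V B" ..
  from choice[OF this] obtain V where "\<forall>i. \<exists>B. Q i (\<phi> i) (V i) B" ..
  from choice[OF this] obtain B where Q: "\<forall>i. Q i (\<phi> i) (V i) (B i)" ..
  have *: "stiefel_param (V i k) (\<phi> i k)" "B i k \<in> sets borel" "B i k \<subseteq> V i k"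
      "A i \<subseteq> (\<Union>k. \<phi> i k ` B i k)" for i k
    using Q by (simp_all add: Q_def)
  have less: "(\<Sum>k. param_volume (\<phi> i k) (B i k)) <
      riemannian_volume (A i) + ennreal (e * (1/2) ^ Suc i)" for i
    using Q by (simp add: Q_def)
  let ?f = "\<lambda>p. param_volume (\<phi> (fst p) (snd p)) (B (fst p) (snd p))"
  have "riemannian_volume (\<Union>i. A i) \<le> (\<Sum>k. ?f (prod_decode k))"
  proof (rule riemannian_volume_le[where V = "\<lambda>k. V (fst (prod_decode k)) (snd (prod_decode k))"])
    show "(\<Union>i. A i) \<subseteq> (\<Union>k. \<phi> (fst (prod_decode k)) (snd (prod_decode k)) `
        B (fst (prod_decode k)) (snd (prod_decode k)))"
    proof
      fix u assume "u \<in> (\<Union>i. A i)"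
      then obtain i k where "u \<in> \<phi> i k ` B i k"
        using *(4) by blast
      then show "u \<in> (\<Union>k. \<phi> (fst (prod_decode k)) (snd (prod_decode k)) `
          B (fst (prod_decode k)) (snd (prod_decode k)))"
        by (intro UN_I[of "prod_encode (i, k)"]) simp_all
    qed
  qed (use * in auto)
  also have "\<dots> = (\<Sum>i. \<Sum>k. param_volume (\<phi> i k) (B i k))"
    by (rule suminf_ennreal_2dimen) simp
  also have "\<dots> \<le> (\<Sum>i. riemannian_volume (A i) + ennreal (e * (1/2) ^ Suc i))"
    using less by (intro suminf_le) (auto intro: less_imp_le)
  also have "\<dots> = (\<Sum>i. riemannian_volume (A i)) + (\<Sum>i. ennreal (e * (1/2) ^ Suc i))"
    by (rule suminf_add[symmetric]) auto
  also have "(\<Sum>i. ennreal (e * (1/2) ^ Suc i)) = ennreal e"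
    using e sums_mult[OF power_half_series, of e] by (intro suminf_ennreal_eq) auto
  finally show "riemannian_volume (\<Union>i. A i) \<le> (\<Sum>i. riemannian_volume (A i)) + ennreal e" .
qed

lemma riemannian_volume_superadditive:
  fixes A :: "nat \<Rightarrow> (real^'d^'n) set"
  assumes A: "\<And>i. A i \<in> sets borel" and disj: "disjoint_family A"
  shows "(\<Sum>i. riemannian_volume (A i)) \<le> riemannian_volume (\<Union>i. A i)"
proof (rule dense_ge)
  fix c assume "riemannian_volume (\<Union>i. A i) < c"
  then obtain \<phi> V B where
    *: "\<And>k::nat. stiefel_param (V k) (\<phi> k)" "\<And>k. B k \<in> sets borel" "\<And>k. B k \<subseteq> V k"
      "(\<Union>i. A i) \<subseteq> (\<Union>k. \<phi> k ` B k)"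
    and less: "(\<Sum>k. param_volume (\<phi> k) (B k)) < c"
    by (rule riemannian_volume_approx) (rule that)
  define C where "C i k = B k \<inter> \<phi> k -` A i" for i k
  define M where "M k = density lborel
    (\<lambda>x. ennreal (sqrt (det (metric_matrix (\<phi> k) x))) * indicator (V k) x)" for k
  have C: "C i k \<in> sets borel" for i k
  proof -
    have "\<phi> k \<in> borel_measurable (restrict_space borel (B k))"
      using stiefel_param_continuous_on[OF *(1)] *(3)
      by (intro borel_measurable_continuous_on_restrict) (blast intro: continuous_on_subset)
    from measurable_sets[OF this A[of i]] show ?thesis
      using *(2)[of k] by (auto simp: C_def sets_restrict_space_iff space_restrict_space Int_commute)
  qed
  have CV: "C i k \<subseteq> V k" for i k
    using *(3) by (auto simp: C_def)
  have cover: "A i \<subseteq> (\<Union>k. \<phi> k ` C i k)" for i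
  proof
    fix u assume u: "u \<in> A i"
    then obtain k x where "x \<in> B k" "u = \<phi> k x"
      using *(4) by blast
    with u show "u \<in> (\<Union>k. \<phi> k ` C i k)"
      by (auto simp: C_def)
  qed
  have "(\<Sum>i. riemannian_volume (A i)) \<le> (\<Sum>i. \<Sum>k. param_volume (\<phi> k) (C i k))"
    by (intro suminf_le riemannian_volume_le[OF *(1) C CV cover] summableI)
  also have "\<dots> = (\<Sum>i. \<Sum>k. emeasure (M k) (C i k))"
    by (simp only: M_def param_volume_eq_emeasure[OF *(1) C CV])
  also have "\<dots> = (\<integral>\<^sup>+ i. (\<Sum>k. emeasure (M k) (C i k)) \<partial>count_space UNIV)"
    by (rule nn_integral_count_space_nat[symmetric])
  also have "\<dots> = (\<Sum>k. \<integral>\<^sup>+ i. emeasure (M k) (C i k) \<partial>count_space UNIV)"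
    by (rule nn_integral_suminf) simp
  also have "\<dots> = (\<Sum>k. \<Sum>i. emeasure (M k) (C i k))"
    by (simp only: nn_integral_count_space_nat)
  also have "\<dots> = (\<Sum>k. emeasure (M k) (\<Union>i. C i k))"
  proof (intro arg_cong[where f = suminf] ext suminf_emeasure)
    show "range (\<lambda>i. C i k) \<subseteq> sets (M k)" for k
      using C by (auto simp: M_def)
    show "disjoint_family (\<lambda>i. C i k)" for k
      using disj by (fastforce simp: C_def disjoint_family_on_def)
  qed
  also have "\<dots> \<le> (\<Sum>k. emeasure (M k) (B k))"
  proof (intro suminf_le emeasure_mono summableI)
    show "(\<Union>i. C i k) \<subseteq> B k" for k
      by (auto simp: C_def)
    show "B k \<in> sets (M k)" for k
      using *(2) by (simp add: M_def)
  qed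
  also have "\<dots> = (\<Sum>k. param_volume (\<phi> k) (B k))"
    by (simp only: M_def param_volume_eq_emeasure[OF *(1-3)])
  finally show "(\<Sum>i. riemannian_volume (A i)) \<le> c"
    using less by simp
qed

lemma closed_stiefel: "closed (stiefel :: (real^'d^'n) set)"
  unfolding stiefel_def matrix_matrix_mult_def transpose_def
  by (intro closed_Collect_eq continuous_intros)

lemma space_stiefel_volume: "space (stiefel_volume :: (real^'d^'n) measure) = stiefel"
  unfolding stiefel_volume_def by (rule space_measure_of) (auto simp: sets_restrict_space)

lemma sets_stiefel_volume:
  "sets (stiefel_volume :: (real^'d^'n) measure) = sets (restrict_space borel stiefel)"
  using sets.sets_measure_of_eq[of "restrict_space borel (stiefel :: (real^'d^'n) set)"]
  unfolding stiefel_volume_def by (simp add: space_restrict_space)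

lemma emeasure_stiefel_volume:
  fixes A :: "(real^'d^'n) set"
  assumes "A \<in> sets (restrict_space borel stiefel)"
  shows "emeasure stiefel_volume A = riemannian_volume A"
  unfolding stiefel_volume_def
proof (rule emeasure_measure_of_sigma)
  let ?S = "sets (restrict_space borel (stiefel :: (real^'d^'n) set))"
  show "sigma_algebra stiefel ?S"
    using sets.sigma_algebra_axioms[of "restrict_space borel (stiefel :: (real^'d^'n) set)"]
    by (simp add: space_restrict_space)
  show "positive ?S riemannian_volume"
    by (simp add: positive_def riemannian_volume_empty)
  show "countably_additive ?S riemannian_volume"
    unfolding countably_additive_def
  proof (intro allI impI antisym)
    fix A :: "nat \<Rightarrow> (real^'d^'n) set"
    assume A: "range A \<subseteq> ?S" "disjoint_family A"
    have "A i \<in> sets borel" for i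
    proof -
      have "A i \<in> ?S"
        using A(1) by (rule range_subsetD)
      then obtain X where "X \<in> sets borel" "A i = stiefel \<inter> X"
        unfolding sets_restrict_space by (rule imageE)
      then show ?thesis
        by (simp add: borel_closed[OF closed_stiefel] sets.Int)
    qed
    with A(2) show "(\<Sum>i. riemannian_volume (A i)) \<le> riemannian_volume (\<Union>i. A i)"
      by (intro riemannian_volume_superadditive)
  qed (rule riemannian_volume_subadditive)
qed (fact assms)

end

theory Submission
  imports Defs "HOL-Probability.Probability_Measure"
begin

text \<open>Since \<open>\<epsilon> > \<surd>(d/n)\<close>, a row can only deviate upwards, and it suffices to bound the probability of
  \<open>norm (U $ i) \<ge> \<epsilon>\<close> for each \<open>i\<close>. The canonical metric, hence the symmetric measure, is invariant
  under \<open>U \<mapsto> Q ** U\<close> for orthogonal \<open>Q\<close>, so the coordinate vector \<open>e\<^sub>i\<close> in \<open>U $ i = transpose U *v e\<^sub>i\<close>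
  may be replaced by a random direction \<open>v\<close>, drawn uniformly from the unit ball. For fixed \<open>U\<close>, the
  set of those \<open>v\<close> in the ball with \<open>norm (transpose U *v v) \<ge> \<epsilon> * norm v\<close> is mapped back into the
  ball by a linear map of determinant \<open>(1 + \<epsilon>\<^sup>2/2)\<close> to the power \<open>n/2\<close> divided by \<open>2\<close> to the power
  \<open>d/2\<close>, so it occupies only a small fraction of the ball. The constant in the theorem leaves room for
  the union bound over \<open>i\<close>.\<close>

section \<open>Orthogonal invariance of the canonical metric and the Riemannian volume\<close>

lemma has_derivative_matrix_mult:
  fixes Q :: "real^'m^'k" and f :: "'a::real_normed_vector \<Rightarrow> real^'d^'m"
  assumes "(f has_derivative f') F"
  shows "((\<lambda>x. Q ** f x) has_derivative (\<lambda>h. Q ** f' h)) F"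
proof -
  have "linear (\<lambda>A::real^'d^'m. Q ** A)"
    by (rule linearI) (simp_all add: matrix_add_ldistrib matrix_scalar_ac scalar_matrix_assoc)
  then show ?thesis
    using assms by (simp add: bounded_linear.has_derivative linear_conv_bounded_linear)
qed

lemma orthogonal_matrix_mult_cancel:
  fixes Q :: "real^'n^'n"
  assumes "orthogonal_matrix Q"
  shows "transpose Q ** (Q ** A) = A" and "Q ** (transpose Q ** B) = B"
  using assms by (simp_all add: matrix_mul_assoc orthogonal_matrix_def)

lemma orthogonal_mult_in_stiefel:
  fixes Q :: "real^'n^'n" and U :: "real^'d^'n"
  assumes "orthogonal_matrix Q" "U \<in> stiefel"
  shows "Q ** U \<in> stiefel"
  using assms by (simp add: stiefel_def matrix_transpose_mul orthogonal_matrix_mult_cancel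
      flip: matrix_mul_assoc)

text \<open>Once \<open>mat 1 - (1/2) *\<^sub>R (U ** transpose U)\<close> is multiplied out, the
  metric depends only on products of the form \<open>transpose C ** D\<close>, and in these
  \<open>transpose Q ** Q\<close> cancels.\<close>

lemma canonical_metric_orthogonal_mult:
  fixes Q :: "real^'n^'n" and U :: "real^'d^'n"
  assumes Q: "orthogonal_matrix Q"
  shows "canonical_metric (Q ** U) (Q ** A) (Q ** B) = canonical_metric U A B"
proof -
  have sub: "(M - c *\<^sub>R N) ** C = M ** C - c *\<^sub>R (N ** C)"
    for M N :: "real^'n^'n" and C :: "real^'d^'n" and c :: real
    by (simp add: vec_eq_iff matrix_matrix_mult_def sum_subtractf sum_distrib_left algebra_simps)
  have mult_sub: "N ** (B - c *\<^sub>R C) = N ** B - c *\<^sub>R (N ** C)"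
    for N :: "real^'n^'d" and B C :: "real^'d^'n" and c :: real
    by (simp add: vec_eq_iff matrix_matrix_mult_def sum_subtractf sum_distrib_left algebra_simps)
  have "canonical_metric V C D =
      trace (transpose C ** D - (1/2) *\<^sub>R (transpose C ** (V ** (transpose V ** D))))"
    for V C D :: "real^'d^'n"
    unfolding canonical_metric_def matrix_mul_assoc[symmetric] sub mult_sub by simp
  moreover have "transpose (Q ** V) ** (Q ** C) = transpose V ** C" for V C :: "real^'d^'n"
    by (simp add: matrix_transpose_mul orthogonal_matrix_mult_cancel[OF Q] flip: matrix_mul_assoc)
  moreover have "transpose (Q ** V) ** ((Q ** W) ** X) = transpose V ** (W ** X)"
    for V W :: "real^'d^'n" and X :: "real^'d^'d"
    by (simp add: matrix_transpose_mul orthogonal_matrix_mult_cancel[OF Q] flip: matrix_mul_assoc)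
  ultimately show ?thesis
    by simp
qed

context
  fixes V :: "('n::finite, 'd::finite) stiefel_coords set"
    and \<phi> :: "('n, 'd) stiefel_coords \<Rightarrow> real^'d^'n" and Q :: "real^'n^'n"
  assumes \<phi>: "stiefel_param V \<phi>" and Q: "orthogonal_matrix Q"
begin

lemma frechet_derivative_orthogonal_mult:
  assumes "x \<in> V"
  shows "frechet_derivative (\<lambda>x. Q ** \<phi> x) (at x) = (\<lambda>h. Q ** frechet_derivative \<phi> (at x) h)"
proof -
  have "(\<phi> has_derivative frechet_derivative \<phi> (at x)) (at x)"
    using \<phi> assms by (simp add: stiefel_param_def frechet_derivative_works)
  from frechet_derivative_at[OF has_derivative_matrix_mult[OF this, of Q]] show ?thesis
    by simp
qed

text \<open>Left multiplication by \<open>Q\<close> is linear, injective and preserves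
  \<open>stiefel\<close>, so it can be composed with any parametrization; derivatives are multiplied
  by \<open>Q\<close> as well.\<close>

lemma stiefel_param_orthogonal_mult: "stiefel_param V (\<lambda>x. Q ** \<phi> x)"
  unfolding stiefel_param_def
proof (intro conjI ballI allI)
  show "open V"
    using \<phi> by (simp add: stiefel_param_def)
  show "(\<lambda>x. Q ** \<phi> x) ` V \<subseteq> stiefel"
    using \<phi> orthogonal_mult_in_stiefel[OF Q] by (auto simp: stiefel_param_def)
  have inj: "inj (\<lambda>A :: real^'d^'n. Q ** A)"
    by (metis orthogonal_matrix_mult_cancel(1)[OF Q] injI)
  then show "inj_on (\<lambda>x. Q ** \<phi> x) V"
    using \<phi> by (auto simp: stiefel_param_def inj_on_def)
  show "(\<lambda>x. Q ** \<phi> x) differentiable at x" if "x \<in> V" for x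
    using \<phi> that has_derivative_matrix_mult unfolding stiefel_param_def differentiable_def by blast
  show "inj (frechet_derivative (\<lambda>x. Q ** \<phi> x) (at x))" if "x \<in> V" for x
    using \<phi> that inj by (simp add: stiefel_param_def frechet_derivative_orthogonal_mult inj_def)
  show "continuous_on V (\<lambda>x. frechet_derivative (\<lambda>x. Q ** \<phi> x) (at x) h)" for h
  proof -
    have "continuous_on V (\<lambda>x. frechet_derivative \<phi> (at x) h)"
      using \<phi> by (simp add: stiefel_param_def)
    then have "continuous_on V (\<lambda>x. Q ** frechet_derivative \<phi> (at x) h)"
      unfolding matrix_matrix_mult_def by (intro continuous_intros)
    then show ?thesis
      by (rule continuous_on_eq) (simp add: frechet_derivative_orthogonal_mult)
  qed
qed

lemma param_volume_orthogonal_mult: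
  assumes "B \<subseteq> V"
  shows "param_volume (\<lambda>x. Q ** \<phi> x) B = param_volume \<phi> B"
proof -
  have "metric_matrix (\<lambda>x. Q ** \<phi> x) x = metric_matrix \<phi> x" if "x \<in> B" for x
    using that assms
    by (simp add: metric_matrix_def frechet_derivative_orthogonal_mult subset_iff
        canonical_metric_orthogonal_mult[OF Q])
  then show ?thesis
    unfolding param_volume_def by (intro nn_integral_cong) (simp add: indicator_def)
qed

end

lemma riemannian_volume_mono:
  fixes A B :: "(real^'d^'n) set"
  assumes "A \<subseteq> B"
  shows "riemannian_volume A \<le> riemannian_volume B"
proof (rule dense_ge)
  fix c assume "riemannian_volume B < c"
  then obtain \<phi> V C where
    *: "\<And>k::nat. stiefel_param (V k) (\<phi> k)" "\<And>k. C k \<in> sets borel" "\<And>k. C k \<subseteq> V k"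
      "B \<subseteq> (\<Union>k. \<phi> k ` C k)"
    and less: "(\<Sum>k. param_volume (\<phi> k) (C k)) < c"
    by (rule riemannian_volume_approx) (rule that)
  have "riemannian_volume A \<le> (\<Sum>k. param_volume (\<phi> k) (C k))"
    using *(1-3) by (rule riemannian_volume_le) (use assms *(4) in order)
  with less show "riemannian_volume A \<le> c"
    by simp
qed

text \<open>Composing every parametrization of a near-optimal cover with \<open>Q\<close> yields a
  cover of the image at the same cost. The reverse inequality is the same statement for
  \<open>transpose Q\<close>.\<close>

lemma riemannian_volume_orthogonal_mult_le:
  fixes Q :: "real^'n^'n" and A :: "(real^'d^'n) set"
  assumes Q: "orthogonal_matrix Q"
  shows "riemannian_volume ((\<lambda>U. Q ** U) ` A) \<le> riemannian_volume A"
proof (rule dense_ge)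
  fix c assume "riemannian_volume A < c"
  then obtain \<phi> V B where
    *: "\<And>k::nat. stiefel_param (V k) (\<phi> k)" "\<And>k. B k \<in> sets borel" "\<And>k. B k \<subseteq> V k"
      "A \<subseteq> (\<Union>k. \<phi> k ` B k)"
    and less: "(\<Sum>k. param_volume (\<phi> k) (B k)) < c"
    by (rule riemannian_volume_approx) (rule that)
  have "riemannian_volume ((\<lambda>U. Q ** U) ` A) \<le> (\<Sum>k. param_volume (\<lambda>x. Q ** \<phi> k x) (B k))"
  proof (rule riemannian_volume_le[where V = V])
    show "(\<lambda>U. Q ** U) ` A \<subseteq> (\<Union>k. (\<lambda>x. Q ** \<phi> k x) ` B k)"
      using *(4) by blast
  qed (rule stiefel_param_orthogonal_mult[OF *(1) Q] *)+
  also have "\<dots> = (\<Sum>k. param_volume (\<phi> k) (B k))"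
    by (simp add: param_volume_orthogonal_mult[OF *(1) Q *(3)])
  finally show "riemannian_volume ((\<lambda>U. Q ** U) ` A) \<le> c"
    using less by simp
qed

section \<open>Linear maps that scale the span of an orthonormal family\<close>

text \<open>An orthogonal matrix taking a coordinate vector to \<open>u\<close> conjugates the map
  to a diagonal one with a single entry \<open>1 + c\<close> and all others 1.\<close>

lemma det_matrix_add_rank_one:
  fixes u :: "real^'n"
  assumes u: "norm u = 1"
  shows "det (matrix (\<lambda>v. v + (c * (u \<bullet> v)) *\<^sub>R u)) = 1 + c"
proof -
  \<comment> \<open>Index types are nonempty, and any coordinate \<open>k\<close> serves.\<close>
  obtain k :: 'n where True by simp
  obtain Q where Q: "orthogonal_matrix Q" and Qk: "Q *v axis k 1 = u"
    using orthogonal_matrix_exists_basis[OF u] by metis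
  define D :: "real^'n^'n" where "D = (\<chi> i j. if i = j then (if i = k then 1 + c else 1) else 0)"
  have "det D = (\<Prod>i\<in>UNIV. if i = k then 1 + c else 1)"
    by (subst det_diagonal) (simp_all add: D_def)
  then have "det D = 1 + c"
    by (simp add: prod.delta)
  have "(D *v w) $ i = (if i = k then 1 + c else 1) * w $ i" for w i
  proof -
    have "(D *v w) $ i = (\<Sum>j\<in>UNIV. if i = j then (if i = k then 1 + c else 1) * w $ i else 0)"
      unfolding matrix_vector_mult_def D_def vec_lambda_beta by (intro sum.cong) auto
    then show ?thesis
      by simp
  qed
  then have Dv: "D *v w = w + (c * (axis k 1 \<bullet> w)) *\<^sub>R axis k 1" for w
    by (simp add: vec_eq_iff inner_axis') (simp add: axis_def algebra_simps)
  have "(Q ** D ** transpose Q) *v v = v + (c * (u \<bullet> v)) *\<^sub>R u" for v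
  proof -
    have "(Q ** D ** transpose Q) *v v = Q *v (D *v (transpose Q *v v))"
      by (simp only: matrix_vector_mul_assoc matrix_mul_assoc)
    also have "\<dots> = Q *v (transpose Q *v v) + (c * (axis k 1 \<bullet> (transpose Q *v v))) *\<^sub>R u"
      by (simp only: Dv Qk matrix_vector_right_distrib matrix_vector_mult_scaleR)
    also have "axis k 1 \<bullet> (transpose Q *v v) = u \<bullet> v"
      unfolding transpose_matrix_vector Qk[symmetric] inner_commute[of "axis k 1"] dot_lmul_matrix
      by (rule inner_commute)
    also have "Q *v (transpose Q *v v) = v"
      using Q by (simp add: matrix_vector_mul_assoc orthogonal_matrix_def del: transpose_matrix_vector)
    finally show ?thesis .
  qed
  then have "(\<lambda>v. v + (c * (u \<bullet> v)) *\<^sub>R u) = (*v) (Q ** D ** transpose Q)"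
    by auto
  then have "det (matrix (\<lambda>v. v + (c * (u \<bullet> v)) *\<^sub>R u)) = det (Q ** D ** transpose Q)"
    by simp
  also have "\<dots> = det D * (det Q * det Q)"
    by (simp add: det_mul det_transpose)
  also have "det Q * det Q = 1"
    using det_orthogonal_matrix[OF Q] by auto
  finally show ?thesis
    using \<open>det D = 1 + c\<close> by simp
qed

lemma linear_add_sum_projections:
  fixes u :: "'j \<Rightarrow> real^'n"
  shows "linear (\<lambda>v. v + c *\<^sub>R (\<Sum>j\<in>S. (u j \<bullet> v) *\<^sub>R u j))"
  by (rule linearI)
     (simp_all add: inner_add_right scaleR_add_left sum.distrib scaleR_sum_right algebra_simps)

text \<open>The family is added one vector at a time: a new \<open>u j\<close> is orthogonal to the
  earlier ones, so the earlier map does not change the component along \<open>u j\<close>. The full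
  map is then a composition of rank-one modifications, each contributing a factor
  \<open>1 + c\<close>.\<close>

lemma det_matrix_add_sum_projections:
  fixes u :: "'j \<Rightarrow> real^'n"
  assumes "finite S" and orth: "\<And>i j. i \<in> S \<Longrightarrow> j \<in> S \<Longrightarrow> u i \<bullet> u j = (if i = j then 1 else 0)"
  shows "det (matrix (\<lambda>v. v + c *\<^sub>R (\<Sum>j\<in>S. (u j \<bullet> v) *\<^sub>R u j))) = (1 + c) ^ card S"
  using assms
proof (induction S rule: finite_induct)
  case empty
  show ?case
    by (simp add: matrix_id_mat_1[unfolded id_def])
next
  case (insert j S)
  let ?F = "\<lambda>S v. v + c *\<^sub>R (\<Sum>j\<in>S. (u j \<bullet> v) *\<^sub>R u j)"
  let ?f = "\<lambda>v. v + (c * (u j \<bullet> v)) *\<^sub>R u j"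
  have "u j \<bullet> u i = 0" if "i \<in> S" for i
    using insert.prems[of j i] insert.hyps that by auto
  then have "u j \<bullet> ?F S v = u j \<bullet> v" for v
    by (simp add: inner_add_right inner_sum_right)
  then have "?F (insert j S) = ?f \<circ> ?F S"
    using insert.hyps by (auto simp: algebra_simps)
  moreover have "matrix (?f \<circ> ?F S) = matrix ?f ** matrix (?F S)"
    using linear_add_sum_projections[where S = "{j}"]
    by (intro matrix_compose linear_add_sum_projections) simp
  moreover have "norm (u j) = 1"
    using insert.prems[of j j] by (simp add: norm_eq_sqrt_inner)
  ultimately show ?case
    using insert by (simp add: det_mul det_matrix_add_rank_one)
qed

text \<open>The sum \<open>?p\<close> is the orthogonal projection of \<open>v\<close> onto the
  span, so \<open>v \<bullet> ?p\<close> and \<open>?p \<bullet> ?p\<close> agree. Only this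
  component is scaled, by \<open>1 + c\<close>.\<close>

lemma norm_add_sum_projections:
  fixes u :: "'j \<Rightarrow> 'a::real_inner"
  assumes "finite S" and orth: "\<And>i j. i \<in> S \<Longrightarrow> j \<in> S \<Longrightarrow> u i \<bullet> u j = (if i = j then 1 else 0)"
  shows "(norm (v + c *\<^sub>R (\<Sum>j\<in>S. (u j \<bullet> v) *\<^sub>R u j)))\<^sup>2 =
    (norm v)\<^sup>2 + ((1 + c)\<^sup>2 - 1) * (\<Sum>j\<in>S. (u j \<bullet> v)\<^sup>2)"
proof -
  let ?p = "\<Sum>j\<in>S. (u j \<bullet> v) *\<^sub>R u j"
  have "v \<bullet> ?p = (\<Sum>j\<in>S. (u j \<bullet> v)\<^sup>2)"
    by (simp add: inner_sum_right power2_eq_square inner_commute)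
  moreover have "?p \<bullet> ?p = (\<Sum>j\<in>S. (u j \<bullet> v)\<^sup>2)"
  proof -
    have "?p \<bullet> ?p = (\<Sum>i\<in>S. \<Sum>j\<in>S. (u i \<bullet> v) * (u j \<bullet> v) * (u i \<bullet> u j))"
      unfolding inner_sum_left inner_sum_right by (intro sum.cong refl) (simp add: inner_commute)
    also have "\<dots> = (\<Sum>i\<in>S. \<Sum>j\<in>S. if i = j then (u i \<bullet> v)\<^sup>2 else 0)"
      using orth by (intro sum.cong) (auto simp: power2_eq_square)
    finally show ?thesis
      using \<open>finite S\<close> by simp
  qed
  ultimately show ?thesis
    unfolding power2_norm_eq_inner
    by (simp add: inner_add_left inner_add_right inner_commute[of ?p v] power2_eq_square algebra_simps)
qed

text \<open>Stretching by \<open>\<surd>(1 + s\<^sup>2/2)\<close> and shrinking by a further factor \<open>\<surd>2\<close> in the span of the \<open>u j\<close>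
  maps the set in question into the ball again.\<close>
lemma measure_ball_large_projection:
  fixes u :: "'j::finite \<Rightarrow> real^'n::{finite,wellorder}"
  assumes orth: "\<And>i j. u i \<bullet> u j = (if i = j then 1 else 0)"
  shows "measure lebesgue {v \<in> cball 0 1. (s * norm v)\<^sup>2 \<le> (\<Sum>j\<in>UNIV. (u j \<bullet> v)\<^sup>2)}
    \<le> sqrt 2 ^ CARD('j) / sqrt (1 + s\<^sup>2 / 2) ^ CARD('n) * measure lebesgue (cball 0 1 :: (real^'n::_) set)"
proof -
  let ?K = "{v \<in> cball 0 1. (s * norm v)\<^sup>2 \<le> (\<Sum>j\<in>UNIV. (u j \<bullet> v)\<^sup>2)}"
  \<comment> \<open>With this choice \<open>1 + c = 1 / sqrt 2\<close>, so \<open>F\<close> halves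
    the squared length of the projection onto the span and fixes its orthogonal complement.\<close>
  define c where "c = 1 / sqrt 2 - 1"
  define \<alpha> where "\<alpha> = sqrt (1 + s\<^sup>2 / 2)"
  define F where "F v = v + c *\<^sub>R (\<Sum>j\<in>UNIV. (u j \<bullet> v) *\<^sub>R u j)" for v
  have c2: "(1 + c)\<^sup>2 = 1 / 2"
    by (simp add: c_def power_divide)
  have \<alpha>2: "\<alpha>\<^sup>2 = 1 + s\<^sup>2 / 2" and \<alpha>_pos: "\<alpha> > 0"
    by (simp_all add: \<alpha>_def add_pos_nonneg)
  have lin: "linear F"
    unfolding F_def by (rule linear_add_sum_projections)
  have "det (matrix ((*\<^sub>R) \<alpha> \<circ> F)) = \<alpha> ^ CARD('n) * (1 + c) ^ CARD('j)"
    using det_matrix_add_sum_projections[of UNIV u c] orth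
    by (subst matrix_compose[OF lin]) (simp_all add: det_mul F_def[abs_def])
  moreover have "1 + c = 1 / sqrt 2"
    by (simp add: c_def)
  ultimately have det: "\<bar>det (matrix ((*\<^sub>R) \<alpha> \<circ> F))\<bar> = \<alpha> ^ CARD('n) / sqrt 2 ^ CARD('j)"
    using \<alpha>_pos by (simp add: power_divide)
  have linG: "linear ((*\<^sub>R) \<alpha> \<circ> F)"
    by (intro linear_compose lin) simp
  have "compact ?K"
  proof -
    have "closed {v::real^'n::_. (s * norm v)\<^sup>2 \<le> (\<Sum>j\<in>UNIV. (u j \<bullet> v)\<^sup>2)}"
      by (intro closed_Collect_le continuous_intros)
    then have "compact (cball 0 1 \<inter> {v. (s * norm v)\<^sup>2 \<le> (\<Sum>j\<in>UNIV. (u j \<bullet> v)\<^sup>2)})"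
      by (intro compact_Int_closed) auto
    then show ?thesis
      by (simp only: Collect_conj_eq Collect_mem_eq)
  qed
  then have K: "?K \<in> lmeasurable"
    by (rule lmeasurable_compact)
  have sub: "((*\<^sub>R) \<alpha> \<circ> F) ` ?K \<subseteq> cball 0 1"
  proof clarsimp
    fix v :: "real^'n::_"
    let ?p = "\<Sum>j\<in>UNIV. (u j \<bullet> v)\<^sup>2"
    assume v: "norm v \<le> 1" and p: "(s * norm v)\<^sup>2 \<le> ?p"
    have "(norm (\<alpha> *\<^sub>R F v))\<^sup>2 = (1 + s\<^sup>2 / 2) * ((norm v)\<^sup>2 - ?p / 2)"
      using norm_add_sum_projections[of UNIV u v c] orth c2
      by (simp add: F_def power_mult_distrib \<alpha>2)
    also have "\<dots> \<le> (1 + s\<^sup>2 / 2) * ((norm v)\<^sup>2 - (s * norm v)\<^sup>2 / 2)"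
      using p by (intro mult_left_mono) (auto simp: add_nonneg_nonneg)
    \<comment> \<open>With \<open>t = s\<^sup>2 / 2\<close> the two factors are \<open>1 + t\<close>
      and \<open>1 - t\<close>; their product is at most 1, which is what \<open>\<alpha>\<close> is
      chosen for.\<close>
    also have "\<dots> = (1 - (s\<^sup>2 / 2)\<^sup>2) * (norm v)\<^sup>2"
      by (simp add: power2_eq_square algebra_simps)
    also have "\<dots> \<le> 1 * 1\<^sup>2"
      using v by (intro mult_mono power_mono) auto
    finally have "(\<alpha> * norm (F v))\<^sup>2 \<le> 1\<^sup>2"
      using \<alpha>_pos by simp
    then show "\<bar>\<alpha>\<bar> * norm (F v) \<le> 1"
      using \<alpha>_pos power2_le_imp_le[of "\<alpha> * norm (F v)" 1] by simp
  qed
  have "\<alpha> ^ CARD('n) / sqrt 2 ^ CARD('j) * measure lebesgue ?K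
      = measure lebesgue (((*\<^sub>R) \<alpha> \<circ> F) ` ?K)"
    by (simp only: measure_linear_image[OF linG K] det)
  also have "\<dots> \<le> measure lebesgue (cball 0 1 :: (real^'n::_) set)"
    by (intro measure_mono_fmeasurable sub fmeasurableD measurable_linear_image linG K
        lmeasurable_cball)
  finally show ?thesis
    using \<alpha>_pos by (simp add: \<alpha>_def field_simps)
qed

text \<open>The change of variables formula for \<^const>\<open>lebesgue\<close> on \<open>real^'n\<close> is available only for
  well-ordered index types.\<close>
typedef ('n::finite) ordered_index = "{..<CARD('n)}"
  by (rule exI[of _ 0]) simp

instance ordered_index :: (finite) finite
proof
  show "finite (UNIV :: 'a ordered_index set)"
    by (simp add: type_definition.univ[OF type_definition_ordered_index])
qed

lemma CARD_ordered_index: "CARD('n::finite ordered_index) = CARD('n)"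
  by (simp add: type_definition.card[OF type_definition_ordered_index])

instantiation ordered_index :: (finite) wellorder
begin

definition "x \<le> y \<longleftrightarrow> Rep_ordered_index x \<le> Rep_ordered_index y"

definition "x < y \<longleftrightarrow> Rep_ordered_index x < Rep_ordered_index y"

instance
proof
  fix P :: "'a ordered_index \<Rightarrow> bool" and a :: "'a ordered_index"
  assume step: "\<And>x. (\<And>y. y < x \<Longrightarrow> P y) \<Longrightarrow> P x"
  show "P a"
  proof (induction a rule: measure_induct_rule[of Rep_ordered_index])
    case (less x)
    show ?case
      by (rule step) (rule less.IH, simp only: less_ordered_index_def)
  qed
qed (auto simp: less_eq_ordered_index_def less_ordered_index_def Rep_ordered_index_inject)

end

section \<open>Averaging over the unit ball\<close>

lemma inner_column_stiefel:
  fixes U :: "real^'d^'n"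
  assumes "U \<in> stiefel"
  shows "(\<Sum>k\<in>UNIV. U $ k $ i * U $ k $ j) = (if i = j then 1 else 0)"
proof -
  have "(transpose U ** U) $ i $ j = mat 1 $ i $ j"
    using assms by (simp add: stiefel_def)
  then show ?thesis
    by (simp add: matrix_matrix_mult_def transpose_def mat_def)
qed

lemma emeasure_lborel_compact:
  fixes K :: "'a::euclidean_space set"
  assumes "compact K"
  shows "emeasure lborel K = ennreal (measure lebesgue K)"
proof -
  have "emeasure lborel K = emeasure lebesgue K"
    using borel_compact[OF assms] by simp
  also have "\<dots> = ennreal (measure lebesgue K)"
    using lmeasurable_compact[OF assms] by (rule emeasure_eq_measure2)
  finally show ?thesis .
qed

text \<open>The columns of \<open>U\<close> are orthonormal, and the coordinates of
  \<open>transpose U *v w\<close> are the inner products of \<open>w\<close> with them, so the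
  estimate for orthonormal families applies. The bijection \<open>q\<close> only relabels
  coordinates by the well-ordered index type.\<close>

lemma emeasure_large_projection:
  fixes U :: "real^'d^'n" and q :: "'n::finite ordered_index \<Rightarrow> 'n"
  assumes q: "bij q" and U: "U \<in> stiefel"
  shows "emeasure lborel
      {v \<in> cball 0 1. (s * norm v)\<^sup>2 \<le> (norm (transpose U *v (\<chi> i. v $ inv q i)))\<^sup>2}
    \<le> ennreal (sqrt 2 ^ CARD('d) / sqrt (1 + s\<^sup>2 / 2) ^ CARD('n)
        * measure lebesgue (cball 0 1 :: (real^'n ordered_index) set))"
    (is "emeasure lborel ?K \<le> _")
proof -
  define u :: "'d \<Rightarrow> real^'n ordered_index" where "u j = (\<chi> k. U $ q k $ j)" for j
  have orth: "u i \<bullet> u j = (if i = j then 1 else 0)" for i j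
    using inner_column_stiefel[OF U, of i j] sum.reindex_bij_betw[OF q, of "\<lambda>k. U $ k $ i * U $ k $ j"]
    by (simp add: u_def inner_vec_def)
  have "(transpose U *v (\<chi> i. v $ inv q i)) $ j = u j \<bullet> v" for v j
    using sum.reindex_bij_betw[OF q, of "\<lambda>i. U $ i $ j * v $ inv q i"] q
    by (simp add: u_def inner_vec_def matrix_vector_mult_def transpose_def bij_is_inj)
  then have eq: "(norm (transpose U *v (\<chi> i. v $ inv q i)))\<^sup>2 = (\<Sum>j\<in>UNIV. (u j \<bullet> v)\<^sup>2)" for v
    by (simp add: norm_vec_def L2_set_def sum_nonneg)
  have "closed {v. (s * norm v)\<^sup>2 \<le> (\<Sum>j\<in>UNIV. (u j \<bullet> v)\<^sup>2)}"
    by (intro closed_Collect_le continuous_intros)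
  then have "compact (cball 0 1 \<inter> {v. (s * norm v)\<^sup>2 \<le> (\<Sum>j\<in>UNIV. (u j \<bullet> v)\<^sup>2)})"
    by (intro compact_Int_closed) auto
  then have "compact ?K"
    by (simp only: eq Collect_conj_eq Collect_mem_eq)
  then have "emeasure lborel ?K = ennreal (measure lebesgue ?K)"
    by (rule emeasure_lborel_compact)
  also have "measure lebesgue ?K \<le> sqrt 2 ^ CARD('d) / sqrt (1 + s\<^sup>2 / 2) ^ CARD('n)
        * measure lebesgue (cball 0 1 :: (real^'n ordered_index) set)"
    using measure_ball_large_projection[of u s, OF orth] by (simp only: eq CARD_ordered_index)
  finally show ?thesis
    by (simp add: ennreal_leI)
qed

text \<open>By \<open>inv\<close>, the probability is at most that of \<open>s * norm v \<le> norm (transpose U *v v)\<close> for every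
  vector \<open>v\<close>; averaging over the unit ball and exchanging the integrals leaves a volume for fixed \<open>U\<close>.\<close>
lemma measure_norm_row_ge:
  fixes M :: "(real^'d^'n) measure"
  assumes "prob_space M" and sets_M: "sets M = sets (restrict_space borel stiefel)"
    and inv: "\<And>w. norm w = 1 \<Longrightarrow>
      emeasure M {U \<in> stiefel. s \<le> norm (U $ i)} \<le> emeasure M {U \<in> stiefel. s \<le> norm (transpose U *v w)}"
    and "0 \<le> s"
  shows "measure M {U \<in> stiefel. s \<le> norm (U $ i)} \<le> sqrt 2 ^ CARD('d) / sqrt (1 + s\<^sup>2 / 2) ^ CARD('n)"
proof -
  interpret prob_space M by fact
  interpret pair_sigma_finite M "lborel :: (real^'n ordered_index) measure" ..
  have space_M: "space M = stiefel"
    using sets_eq_imp_space_eq[OF sets_M] by (simp add: space_restrict_space)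
  have "card (UNIV :: 'n ordered_index set) = card (UNIV :: 'n set)"
    by (rule CARD_ordered_index)
  then obtain q :: "'n ordered_index \<Rightarrow> 'n" where q: "bij q"
    using finite_same_card_bij[OF finite finite] by blast
  define f where "f v = (\<chi> i. v $ inv q i)" for v :: "real^'n ordered_index"
  have norm_f: "norm (f v) = norm v" for v
    using sum.reindex_bij_betw[OF bij_imp_bij_inv[OF q], of "\<lambda>k. (v $ k)\<^sup>2"]
    by (simp add: f_def norm_vec_def L2_set_def)
  let ?A = "{U \<in> stiefel. s \<le> norm (U $ i)}"
  let ?B = "cball 0 1 :: (real^'n ordered_index) set"
  define r where "r = sqrt 2 ^ CARD('d) / sqrt (1 + s\<^sup>2 / 2) ^ CARD('n)"
  have "r \<ge> 0"
    by (simp add: r_def)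
  define C where "C = {z :: (real^'d^'n) \<times> (real^'n ordered_index). norm (snd z) \<le> 1
      \<and> (s * norm (snd z))\<^sup>2 \<le> (norm (transpose (fst z) *v f (snd z)))\<^sup>2}"
  \<comment> \<open>\<open>C\<close> is closed in the whole product space, while \<open>M\<close>
    lives on \<open>stiefel\<close>. Pulling back along the identity makes the set measurable for
    the product with \<open>M\<close>.\<close>
  define X where "X = (\<lambda>z. (fst z, snd z)) -` C \<inter> space (M \<Otimes>\<^sub>M lborel)"
  have "closed C"
    unfolding C_def f_def matrix_vector_mult_def transpose_def
    by (intro closed_Collect_conj closed_Collect_le continuous_intros)
  then have C: "C \<in> sets (borel \<Otimes>\<^sub>M borel)"
    unfolding borel_prod by (rule borel_closed)
  have [measurable]: "(\<lambda>U. U) \<in> borel_measurable M"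
    unfolding measurable_cong_sets[OF sets_M refl] by (rule measurable_restrict_space1) simp
  have "(\<lambda>z. (fst z, snd z)) \<in> M \<Otimes>\<^sub>M lborel \<rightarrow>\<^sub>M borel \<Otimes>\<^sub>M borel"
    by measurable
  from measurable_sets[OF this C] have X: "X \<in> sets (M \<Otimes>\<^sub>M lborel)"
    by (simp add: X_def)
  have X_U: "(\<lambda>U. (U, v)) -` X = {U \<in> stiefel. norm v \<le> 1 \<and>
      s * norm v \<le> norm (transpose U *v f v)}" for v
    using \<open>0 \<le> s\<close> by (auto simp: X_def C_def space_pair_measure space_M
        intro: power_mono power2_le_imp_le)
  have "emeasure M ?A * indicator ?B v \<le> emeasure M ((\<lambda>U. (U, v)) -` X)" for v
  proof (cases "v \<in> ?B")
    case True
    \<comment> \<open>For \<open>v = 0\<close> the slice is all of \<open>stiefel\<close>. Otherwise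
      the condition is homogeneous in \<open>v\<close>, so dividing by \<open>norm v\<close> gives a
      unit vector to which \<open>inv\<close> applies.\<close>
    have "emeasure M ?A \<le> emeasure M ((\<lambda>U. (U, v)) -` X)"
    proof (cases "v = 0")
      case True
      then have "(\<lambda>U. (U, v)) -` X = space M"
        by (auto simp: X_U space_M)
      then show ?thesis
        by (simp add: emeasure_space)
    next
      case False
      then have unit: "norm (f v /\<^sub>R norm v) = 1"
        by (simp add: norm_f)
      have "{U \<in> stiefel. s \<le> norm (transpose U *v (f v /\<^sub>R norm v))} = (\<lambda>U. (U, v)) -` X"
        using False True by (auto simp: X_U matrix_vector_mult_scaleR field_simps)
      with inv[OF unit] show ?thesis
        by (simp only:)
    qed
    with True show ?thesis by simp
  qed simp
  then have "(\<integral>\<^sup>+v. emeasure M ?A * indicator ?B v \<partial>lborel) \<le> emeasure (M \<Otimes>\<^sub>M lborel) X"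
    unfolding emeasure_pair_measure_alt2[OF X] by (intro nn_integral_mono)
  also have "\<dots> = (\<integral>\<^sup>+U. emeasure lborel (Pair U -` X) \<partial>M)"
    by (rule lborel.emeasure_pair_measure_alt[OF X])
  also have "\<dots> \<le> (\<integral>\<^sup>+U. ennreal (r * measure lebesgue ?B) \<partial>M)"
  proof (rule nn_integral_mono)
    fix U assume U: "U \<in> space M"
    then have "Pair U -` X = {v \<in> cball 0 1. (s * norm v)\<^sup>2 \<le> (norm (transpose U *v f v))\<^sup>2}"
      by (auto simp: X_def C_def space_pair_measure)
    then show "emeasure lborel (Pair U -` X) \<le> ennreal (r * measure lebesgue ?B)"
      using emeasure_large_projection[OF q, of U s] U by (simp add: f_def r_def space_M)
  qed
  also have "\<dots> = ennreal (r * measure lebesgue ?B)"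
    by (simp add: emeasure_space_1)
  also have "(\<integral>\<^sup>+v. emeasure M ?A * indicator ?B v \<partial>lborel) = emeasure M ?A * emeasure lborel ?B"
    by (rule nn_integral_cmult_indicator) simp
  also have "emeasure lborel ?B = ennreal (measure lebesgue ?B)"
    by (rule emeasure_lborel_compact[OF compact_cball])
  finally have "measure M ?A * measure lebesgue ?B \<le> r * measure lebesgue ?B"
    using \<open>r \<ge> 0\<close> by (simp add: emeasure_eq_measure flip: ennreal_mult)
  moreover have "measure lebesgue ?B > 0"
    using content_cball_pos[of 1 "0 :: real^'n ordered_index"] by simp
  ultimately show ?thesis
    unfolding r_def by (rule mult_right_le_imp_le)
qed

section \<open>Rows of Stiefel points and the symmetric measure\<close>

text \<open>\<open>U\<close> acts as an isometry. Applied to its own row \<open>?w\<close>, it gives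
  a vector of norm \<open>norm ?w\<close> whose coordinate \<open>i\<close> is
  \<open>(norm ?w)\<^sup>2\<close>, and no coordinate exceeds the norm.\<close>

lemma norm_row_stiefel_le:
  fixes U :: "real^'d^'n"
  assumes "U \<in> stiefel"
  shows "norm (U $ i) \<le> 1"
proof -
  let ?w = "U $ i"
  have "(norm (U *v ?w))\<^sup>2 = ?w \<bullet> ((transpose U ** U) *v ?w)"
    by (simp add: power2_norm_eq_inner dot_lmul_matrix matrix_vector_mul_assoc[symmetric]
        flip: transpose_matrix_vector) (metis dot_lmul_matrix transpose_matrix_vector transpose_transpose inner_commute)
  then have "norm (U *v ?w) = norm ?w"
    using assms by (simp add: stiefel_def flip: power2_norm_eq_inner)
  moreover have "(U *v ?w) $ i = (norm ?w)\<^sup>2"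
    by (simp add: matrix_vector_mult_def power2_norm_eq_inner inner_vec_def)
  ultimately have "norm ?w * norm ?w \<le> 1 * norm ?w"
    using component_le_norm_cart[of "U *v ?w" i] by (simp add: power2_eq_square)
  then show ?thesis
    by (cases "?w = 0") auto
qed

lemma sets_stiefel_symmetric: "sets (stiefel_symmetric :: (real^'d^'n) measure) =
    sets (restrict_space borel stiefel)"
  by (simp add: stiefel_symmetric_def sets_stiefel_volume)

lemma space_stiefel_symmetric: "space (stiefel_symmetric :: (real^'d^'n) measure) = stiefel"
  by (simp add: stiefel_symmetric_def space_stiefel_volume)

lemma Collect_norm_mult_vec_sets:
  "{U \<in> stiefel. s \<le> norm (transpose U *v w)} \<in> sets (restrict_space borel (stiefel :: (real^'d^'n) set))"
proof -
  have "closed {U :: real^'d^'n. s \<le> norm (transpose U *v w)}"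
    unfolding matrix_vector_mult_def transpose_def by (intro closed_Collect_le continuous_intros)
  then show ?thesis
    by (auto simp: sets_restrict_space intro!: image_eqI[of _ _ "{U. s \<le> norm (transpose U *v w)}"])
qed

lemma row_eq_transpose_mult_axis: "U $ i = transpose U *v axis i 1"
  for U :: "real^'d^'n"
  by (simp add: matrix_vector_mult_basis column_def transpose_def vec_eq_iff)

text \<open>Choose an orthogonal \<open>Q\<close> with \<open>Q *v axis i 1 = w\<close>. Then
  \<open>transpose (Q ** U) *v w\<close> is row \<open>i\<close> of \<open>U\<close>, so the first
  set lies in the image of the second under \<open>transpose Q\<close>, whose volume is no larger
  than that of the second. This supplies the assumption \<open>inv\<close> of
  \<open>measure_norm_row_ge\<close>.\<close>

lemma emeasure_stiefel_symmetric_norm_row_le: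
  fixes w :: "real^'n" and s :: real
  assumes w: "norm w = 1"
  shows "emeasure (stiefel_symmetric :: (real^'d^'n) measure) {U \<in> stiefel. s \<le> norm (U $ i)}
    \<le> emeasure (stiefel_symmetric :: (real^'d^'n) measure) {U \<in> stiefel. s \<le> norm (transpose U *v w)}"
proof -
  let ?A = "\<lambda>w. {U :: real^'d^'n. U \<in> stiefel \<and> s \<le> norm (transpose U *v w)}"
  have stiefel: "stiefel \<in> sets (stiefel_volume :: (real^'d^'n) measure)"
    using sets.top[of "stiefel_volume :: (real^'d^'n) measure"] by (simp add: space_stiefel_volume)
  have eq: "emeasure stiefel_symmetric (?A w) =
      riemannian_volume (?A w) / emeasure stiefel_volume (stiefel :: (real^'d^'n) set)" for w
  proof -
    have A: "?A w \<in> sets (restrict_space borel stiefel)"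
      by (rule Collect_norm_mult_vec_sets)
    then have "emeasure stiefel_symmetric (?A w) =
        emeasure stiefel_volume (stiefel \<inter> ?A w) / emeasure stiefel_volume (stiefel :: (real^'d^'n) set)"
      unfolding stiefel_symmetric_def
      by (intro emeasure_uniform_measure stiefel) (simp only: sets_stiefel_volume)
    also have "stiefel \<inter> ?A w = ?A w"
      by blast
    finally show ?thesis
      by (simp only: emeasure_stiefel_volume[OF A])
  qed
  obtain Q where Q: "orthogonal_matrix Q" "Q *v axis i 1 = w"
    using orthogonal_matrix_exists_basis[OF w] by metis
  have Qt: "orthogonal_matrix (transpose Q)"
    using Q by (simp add: orthogonal_matrix_transpose)
  have "?A (axis i 1) \<subseteq> (\<lambda>U. transpose Q ** U) ` ?A w"
  proof
    fix U assume U: "U \<in> ?A (axis i 1)"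
    have "transpose (Q ** U) *v w = transpose U *v axis i 1"
      unfolding matrix_transpose_mul Q(2)[symmetric] matrix_vector_mul_assoc matrix_mul_assoc[symmetric]
      using Q(1) by (simp only: orthogonal_matrix_def matrix_mul_rid)
    with U have "Q ** U \<in> ?A w"
      using orthogonal_mult_in_stiefel[OF Q(1), of U] by simp
    then show "U \<in> (\<lambda>U. transpose Q ** U) ` ?A w"
      by (rule rev_image_eqI) (simp add: orthogonal_matrix_mult_cancel[OF Q(1)])
  qed
  then have "riemannian_volume (?A (axis i 1)) \<le> riemannian_volume ((\<lambda>U. transpose Q ** U) ` ?A w)"
    by (rule riemannian_volume_mono)
  also have "\<dots> \<le> riemannian_volume (?A w)"
    by (rule riemannian_volume_orthogonal_mult_le[OF Qt])
  finally show ?thesis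
    unfolding row_eq_transpose_mult_axis eq by (rule divide_right_mono_ennreal)
qed

text \<open>If the total volume were \<open>0\<close> or \<open>\<infinity>\<close>, normalizing would give the zero measure, so that no
  volume of the manifold has to be computed.\<close>
lemma measure_stiefel_symmetric_eq_0:
  fixes A :: "(real^'d^'n) set"
  assumes "\<not> prob_space (stiefel_symmetric :: (real^'d^'n) measure)"
  shows "measure stiefel_symmetric A = 0"
proof -
  let ?M = "stiefel_volume :: (real^'d^'n) measure"
  have *: "emeasure ?M stiefel \<in> {0, \<infinity>}"
    using assms prob_space_uniform_measure[of ?M stiefel] by (auto simp: stiefel_symmetric_def)
  have stiefel: "stiefel \<in> sets ?M"
    using sets.top[of ?M] by (simp add: space_stiefel_volume)
  show ?thesis
  proof (cases "A \<in> sets ?M")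
    case True
    have le: "emeasure ?M (stiefel \<inter> A) \<le> emeasure ?M stiefel"
      using stiefel by (intro emeasure_mono) auto
    have "emeasure stiefel_symmetric A = emeasure ?M (stiefel \<inter> A) / emeasure ?M stiefel"
      unfolding stiefel_symmetric_def by (rule emeasure_uniform_measure[OF stiefel True])
    \<comment> \<open>The quotient is only located in \<open>{0, \<infinity>}\<close>; this suffices
      because \<open>measure\<close> sends both values to 0.\<close>
    with * le have "emeasure stiefel_symmetric A \<in> {0, \<infinity>}"
      by (auto simp: divide_ennreal_def ennreal_mult_eq_top_iff)
    then show ?thesis
      by (auto simp: measure_def)
  next
    case False
    then show ?thesis
      by (intro measure_notin_sets) (simp add: stiefel_symmetric_def)
  qed
qed

section \<open>Exponential tail of a single row and the union bound\<close>

text \<open>This puts the volume ratio into exponential form, using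
  \<open>sqrt 2 \<le> exp (1 / 2)\<close> and
  \<open>exp (s\<^sup>2 / 6) \<le> sqrt (1 + s\<^sup>2 / 2)\<close>; the latter relies on
  \<open>s \<le> 1\<close>.\<close>

lemma measure_stiefel_symmetric_norm_row_ge:
  assumes "prob_space (stiefel_symmetric :: (real^'d^'n) measure)" and s: "0 \<le> s" "s \<le> 1"
  shows "measure (stiefel_symmetric :: (real^'d^'n) measure) {U \<in> stiefel. s \<le> norm (U $ i)}
    \<le> exp (real CARD('d) / 2 - real CARD('n) * s\<^sup>2 / 6)"
proof -
  let ?d = "CARD('d)" and ?n = "CARD('n)"
  have "s\<^sup>2 \<le> 1"
    using s by (simp add: power_le_one)
  have "s\<^sup>2 / 3 \<le> (s\<^sup>2 / 2) / (1 + s\<^sup>2 / 2)"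
  proof -
    \<comment> \<open>The denominator \<open>1 + t / 2\<close> is at most \<open>3 / 2\<close>; this
      is the source of the constant 3.\<close>
    have "t / 3 \<le> (t / 2) / (1 + t / 2)" if "0 \<le> t" "t \<le> 1" for t :: real
      using that mult_right_mono[of t 1 t] by (simp add: field_simps)
    then show ?thesis
      using \<open>s\<^sup>2 \<le> 1\<close> by simp
  qed
  also have "\<dots> \<le> ln (1 + s\<^sup>2 / 2)"
    using ln_add1_ge[of "s\<^sup>2 / 2"] by (simp add: add.commute)
  finally have "exp (s\<^sup>2 / 3) \<le> 1 + s\<^sup>2 / 2"
    by (subst (asm) ln_ge_iff) (simp_all add: add_pos_nonneg)
  then have "sqrt (exp (s\<^sup>2 / 3)) \<le> sqrt (1 + s\<^sup>2 / 2)"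
    by simp
  moreover have "sqrt (exp (s\<^sup>2 / 3)) = exp (s\<^sup>2 / 6)"
    by (rule real_sqrt_unique) (simp_all flip: exp_of_nat_mult)
  ultimately have s6: "exp (s\<^sup>2 / 6) \<le> sqrt (1 + s\<^sup>2 / 2)"
    by simp
  have "sqrt 2 \<le> sqrt (exp 1)"
    using exp_ge_add_one_self[of 1] by simp
  moreover have "sqrt (exp 1) = exp (1 / 2 :: real)"
    by (rule real_sqrt_unique) (simp_all flip: exp_of_nat_mult)
  ultimately have sqrt2: "sqrt 2 \<le> exp (1 / 2)"
    by simp
  have "measure stiefel_symmetric {U :: real^'d^'n. U \<in> stiefel \<and> s \<le> norm (U $ i)}
      \<le> sqrt 2 ^ ?d / sqrt (1 + s\<^sup>2 / 2) ^ ?n"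
    using assms(1) sets_stiefel_symmetric emeasure_stiefel_symmetric_norm_row_le s(1)
    by (rule measure_norm_row_ge)
  also have "\<dots> \<le> exp (1 / 2) ^ ?d / exp (s\<^sup>2 / 6) ^ ?n"
    using s6 sqrt2 by (intro frac_le power_mono) auto
  also have "\<dots> = exp (real ?d / 2 - real ?n * s\<^sup>2 / 6)"
    by (simp add: exp_diff flip: exp_of_nat_mult)
  finally show ?thesis .
qed

text \<open>From \<open>0 \<le> a \<le> \<epsilon>\<close> it follows that \<open>\<epsilon>\<^sup>2
  \<ge> a\<^sup>2 + (\<epsilon> - a)\<^sup>2\<close>. After division by 6, the first summand absorbs
  \<open>d / 2\<close> and the \<open>ln n\<close> of the union bound since
  \<open>153 / 96 \<ge> 1\<close>; the second gives the exponent since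
  \<open>n / 6 \<ge> (n - 2) / 8\<close>. The factor \<open>153 / 16\<close> is the square of
  \<open>3 * sqrt 17 / 4\<close>.\<close>

lemma union_bound_estimate:
  fixes a d n \<epsilon> :: real
  assumes d: "2 \<le> d" and n: "2 \<le> n" and a: "0 \<le> a" "a \<le> \<epsilon>"
    and a2: "a\<^sup>2 = 153 / 16 * ((d + ln n) / n)"
  shows "n * exp (d / 2 - n * \<epsilon>\<^sup>2 / 6) \<le> exp (- ((n - 2) / 8) * (\<epsilon> - a)\<^sup>2)"
proof -
  define x where "x = (\<epsilon> - a)\<^sup>2"
  have "ln n \<ge> 0" "x \<ge> 0"
    using n by (simp_all add: x_def)
  have "a\<^sup>2 + x \<le> \<epsilon>\<^sup>2"
    using a mult_left_mono[of a \<epsilon> a] by (simp add: x_def power2_eq_square algebra_simps)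
  then have "n * (a\<^sup>2 + x) \<le> n * \<epsilon>\<^sup>2"
    using n by (intro mult_left_mono) auto
  moreover have "n * a\<^sup>2 = 153 / 16 * (d + ln n)"
    using n by (simp add: a2)
  ultimately have "153 / 16 * (d + ln n) + n * x \<le> n * \<epsilon>\<^sup>2"
    by (simp only: distrib_left)
  moreover have "(n - 2) * x \<le> n * x" "0 \<le> n * x"
    using n \<open>x \<ge> 0\<close> by (auto intro: mult_right_mono)
  ultimately have "ln n + (d / 2 - n * \<epsilon>\<^sup>2 / 6) \<le> - ((n - 2) * x / 8)"
    using d \<open>ln n \<ge> 0\<close> by argo
  then have "exp (ln n + (d / 2 - n * \<epsilon>\<^sup>2 / 6)) \<le> exp (- ((n - 2) * x / 8))"
    by (rule exp_le_cancel_iff[THEN iffD2])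
  moreover have "exp (ln n + (d / 2 - n * \<epsilon>\<^sup>2 / 6)) = n * exp (d / 2 - n * \<epsilon>\<^sup>2 / 6)"
    using n by (simp only: exp_add) simp
  moreover have "- ((n - 2) / 8) * x = - ((n - 2) * x / 8)"
    by simp
  ultimately show ?thesis
    by (simp only: x_def)
qed

theorem theorem3p1:
  fixes \<epsilon> :: real
  assumes "CARD('d::finite) \<ge> 2" and "CARD('n::finite) > CARD('d)"
    and "\<epsilon> > 0"
    and "3 * sqrt 17 / 4 * sqrt ((real CARD('d) + ln (real CARD('n))) / real CARD('n)) < \<epsilon>"
  shows "measure (stiefel_symmetric :: (real^'d^'n) measure)
           {x \<in> space stiefel_symmetric.
              \<exists>i. \<bar>norm (x $ i) - sqrt (real CARD('d) / real CARD('n))\<bar> \<ge> \<epsilon>}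
         \<le> exp (- ((real CARD('n) - 2) / 8) *
              (\<epsilon> - 3 * sqrt 17 / 4 *
                 sqrt ((real CARD('d) + ln (real CARD('n))) / real CARD('n)))\<^sup>2)"
    (is "measure ?P ?E \<le> _")
proof (cases "prob_space ?P")
  case P: True
  interpret prob_space ?P by fact
  define d n where "d = real CARD('d)" and "n = real CARD('n)"
  have d: "d \<ge> 2" and n: "n > d"
    using assms by (simp_all add: d_def n_def)
  have "ln n \<ge> 0"
    using d n by simp
  define a where "a = 3 * sqrt 17 / 4 * sqrt ((d + ln n) / n)"
  have "a \<ge> 0"
    using d n \<open>ln n \<ge> 0\<close> by (simp add: a_def)
  have "a < \<epsilon>"
    using assms(4) by (simp add: a_def d_def n_def)
  have a2: "a\<^sup>2 = 153 / 16 * ((d + ln n) / n)"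
    using d n \<open>ln n \<ge> 0\<close> by (simp add: a_def power_mult_distrib power_divide)
  \<comment> \<open>The factor \<open>153 / 16\<close> exceeds 1 and \<open>ln n\<close> is
    nonnegative, so \<open>sqrt (d / n) \<le> a < \<epsilon>\<close>; a nonnegative norm cannot lie
    \<open>\<epsilon>\<close> below \<open>sqrt (d / n)\<close>.\<close>
  have "d / n \<le> a\<^sup>2"
    using d n \<open>ln n \<ge> 0\<close> by (simp add: a2 field_simps)
  then have "sqrt (d / n) \<le> a"
    using \<open>a \<ge> 0\<close> by (rule real_le_lsqrt[rotated 1])
  then have dn: "sqrt (d / n) < \<epsilon>"
    using \<open>a < \<epsilon>\<close> by simp
  have E: "?E \<subseteq> (\<Union>i. {U \<in> stiefel. \<epsilon> \<le> norm (U $ i)})"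
  proof
    fix U assume "U \<in> ?E"
    then obtain i where U: "U \<in> stiefel" and "\<epsilon> \<le> \<bar>norm (U $ i) - sqrt (d / n)\<bar>"
      by (auto simp: space_stiefel_symmetric d_def n_def)
    moreover have "0 \<le> sqrt (d / n)"
      using d n by simp
    ultimately have "\<epsilon> \<le> norm (U $ i)"
      using dn norm_ge_zero[of "U $ i"] by linarith
    with U show "U \<in> (\<Union>i. {U \<in> stiefel. \<epsilon> \<le> norm (U $ i)})"
      by blast
  qed
  have sets: "{U \<in> stiefel. \<epsilon> \<le> norm (U $ i)} \<in> events" for i
    unfolding sets_stiefel_symmetric row_eq_transpose_mult_axis by (rule Collect_norm_mult_vec_sets)
  show ?thesis
  proof (cases "\<epsilon> \<le> 1")
    case True
    have "measure ?P ?E \<le> measure ?P (\<Union>i. {U \<in> stiefel. \<epsilon> \<le> norm (U $ i)})"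
      using sets by (intro finite_measure_mono E) auto
    also have "\<dots> \<le> (\<Sum>i\<in>UNIV. measure ?P {U \<in> stiefel. \<epsilon> \<le> norm (U $ i)})"
      by (rule finite_measure_subadditive_finite[OF finite]) (rule image_subsetI, rule sets)
    also have "\<dots> \<le> (\<Sum>i\<in>(UNIV :: 'n set). exp (d / 2 - n * \<epsilon>\<^sup>2 / 6))"
      unfolding d_def n_def using \<open>\<epsilon> > 0\<close> True
      by (intro sum_mono measure_stiefel_symmetric_norm_row_ge[OF P]) auto
    also have "\<dots> = n * exp (d / 2 - n * \<epsilon>\<^sup>2 / 6)"
      by (simp add: n_def)
    also have "\<dots> \<le> exp (- ((n - 2) / 8) * (\<epsilon> - a)\<^sup>2)"
      using d _ \<open>a \<ge> 0\<close> _ a2 by (rule union_bound_estimate) (use d n \<open>a < \<epsilon>\<close> in simp_all)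
    finally show ?thesis
      unfolding a_def d_def n_def .
  next
    case False
    \<comment> \<open>The tail estimate covers thresholds up to 1. Rows have norm at most 1, so
      beyond that the event is empty.\<close>
    have "\<not> \<epsilon> \<le> norm (U $ i)" if "U \<in> stiefel" for U :: "real^'d^'n" and i
      using norm_row_stiefel_le[OF that, of i] False by simp
    with E have "?E = {}"
      by blast
    then show ?thesis
      by (simp only: measure_empty exp_ge_zero)
  qed
next
  case False
  show ?thesis
    unfolding measure_stiefel_symmetric_eq_0[OF False] by (rule exp_ge_zero)
qed

end
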